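(* For every $n\ge 3$, let $G_n^4$ be the graph on vertex set $\{1,2,\dots,2n+1,x,y\}$ with the following edges: the path edges $\{i,i+1\}$ for $2\le i\le 2n-1$; the edges $\{1,i\}$ and $\{2n+1,i\}$ for all $2\le i\le 2n$; the edge $\{1,2n+1\}$; and the edges $\{1,x\}$, $\{2n,x\}$, $\{2,y\}$, $\{2n+1,y\}$. There are no other edges. Then $G_n^4$ is a minimal non-word-representable graph, i.e. $G_n^4$ is not word-representable but every proper induced subgraph of it is word-representable.
   Context: All graphs are finite and simple. For a word $w$ and letters $i,j$, let $w_{ij}$ be the subsequence of $w$ consisting of all occurrences of $i$ and $j$; $i$ and $j$ alternate in $w$ if $w_{ij}$ contains no factor $ii$ or $jj$. A graph $G$ is word-representable if there is a word $w$ over $V(G)$ such that for all distinct $i,j\in V(G)$, $\{i,j\}\in E(G)$ if and only if $i$ and $j$ alternate in $w$. *)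

theory Defs
  imports Main "HOL-Library.Sublist"
begin

datatype 'a graph = Graph (verts: "'a set") (edges: "'a set set")

definition simple_graph :: "'a graph \<Rightarrow> bool" where
  "simple_graph G \<longleftrightarrow>
     finite (verts G) \<and> (\<forall>e\<in>edges G. e \<subseteq> verts G \<and> card e = 2)"

definition induced_subgraph :: "'a graph \<Rightarrow> 'a set \<Rightarrow> 'a graph" where
  "induced_subgraph G S = Graph S {e \<in> edges G. e \<subseteq> S}"

definition restrict_word :: "'a list \<Rightarrow> 'a \<Rightarrow> 'a \<Rightarrow> 'a list" where
  "restrict_word w i j = filter (\<lambda>k. k = i \<or> k = j) w"

text \<open>A factor of a word is a contiguous block, i.e. \<^const>\<open>sublist\<close>
  (as opposed to \<^const>\<open>subseq\<close>).\<close>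

definition alternate :: "'a list \<Rightarrow> 'a \<Rightarrow> 'a \<Rightarrow> bool" where
  "alternate w i j \<longleftrightarrow>
     \<not> sublist [i, i] (restrict_word w i j) \<and> \<not> sublist [j, j] (restrict_word w i j)"

text \<open>The word need not contain every vertex. Requiring this would not change the notion: prepending
  the missing vertices, once each and in any order, does not change which pairs alternate.\<close>

definition word_representable :: "'a graph \<Rightarrow> bool" where
  "word_representable G \<longleftrightarrow>
     (\<exists>w\<in>lists (verts G). \<forall>i\<in>verts G. \<forall>j\<in>verts G.
        i \<noteq> j \<longrightarrow> ({i, j} \<in> edges G \<longleftrightarrow> alternate w i j))"

definition minimal_non_word_representable :: "'a graph \<Rightarrow> bool" where
  "minimal_non_word_representable G \<longleftrightarrow>
     \<not> word_representable G \<and>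
     (\<forall>S. S \<subset> verts G \<longrightarrow> word_representable (induced_subgraph G S))"

datatype vertex = N nat | X | Y

definition G4 :: "nat \<Rightarrow> vertex graph" where
  "G4 n = Graph
     (N ` {1..2*n+1} \<union> {X, Y})
     ({{N i, N (i+1)} | i. 2 \<le> i \<and> i \<le> 2*n-1} \<union>
      {{N 1, N i} | i. 2 \<le> i \<and> i \<le> 2*n} \<union>
      {{N (2*n+1), N i} | i. 2 \<le> i \<and> i \<le> 2*n} \<union>
      {{N 1, N (2*n+1)}} \<union>
      {{N 1, X}, {N (2*n), X}, {N 2, Y}, {N (2*n+1), Y}})"

lemma simple_graph_G4:
  assumes "n \<ge> 3"
  shows "simple_graph (G4 n)"
proof -
  have "\<forall>e\<in>edges (G4 n). e \<subseteq> verts (G4 n)"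
    using assms by (auto simp: G4_def)
  moreover have "\<forall>e\<in>edges (G4 n). card e = 2"
    using assms by (auto simp: G4_def card_insert_if)
  moreover have "finite (verts (G4 n))"
    by (simp add: G4_def)
  ultimately show ?thesis
    by (simp add: simple_graph_def)
qed

end

theory Submission
  imports Defs
begin

text \<open>Counting occurrences in prefixes turns a representing word into a semi-transitive orientation, for
  which it suffices to record reachability. In such an orientation of \<open>G4 n\<close> with \<open>1 \<rightarrow> 2n+1\<close>, either every
  path vertex lies between the two hubs, or each lies before both (type \<open>S\<close>) or after both
  (type \<open>T\<close>). The absence of shortcuts yields a proper 2-colouring of the path; the vertices
  \<open>x\<close> and \<open>y\<close> force its two ends to have different colours, although the path has an even number of edges.
  Deleting any vertex removes this obstruction, and explicit words with two or three occurrences of each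
  letter represent what is left.\<close>

section \<open>Alternation and prefix counts\<close>

text \<open>The contradiction combines parity with a symmetry. The path has \<open>2n-2\<close>
  edges, so a proper 2-colouring gives its ends equal colours. Reversing all arcs while exchanging
  the hubs, \<open>X\<close> with \<open>Y\<close>, and \<open>i\<close> with \<open>2n+2-i\<close>
  preserves the setting but turns sinks into sources; whatever \<open>X\<close> forces at
  \<open>2n\<close>, \<open>Y\<close> therefore forces in opposite form at \<open>2\<close>.
  \<open>X\<close> has this power because it is joined to one hub and to \<open>2n\<close>, but
  neither to the other hub nor to \<open>2n-1\<close>: a wrongly directed arc between
  \<open>2n-1\<close> and \<open>2n\<close> yields a shortcut or a cycle. The bound n \<ge> 3
  provides, for each edge of the path, a path vertex adjacent to neither of its ends. For the
  induced subgraphs, a deleted path vertex is where the colouring may change phase. Words are given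
  by integer occurrence times rather than as lists, so that each pair of letters is settled by
  linear arithmetic, uniformly in \<open>n\<close>.\<close>

definition precedes :: "'a list \<Rightarrow> 'a \<Rightarrow> 'a \<Rightarrow> bool" where
  "precedes w i j \<longleftrightarrow>
     (\<forall>m. count_list (take m w) j \<le> count_list (take m w) i \<and>
          count_list (take m w) i \<le> count_list (take m w) j + 1)"

lemma precedes_Nil: "precedes [] i j"
  by (simp add: precedes_def)

lemma all_nat_take_Cons:
  "(\<forall>m. P (take m (a # w))) \<longleftrightarrow> P [] \<and> (\<forall>m. P (a # take m w))"
  by (metis take_Suc_Cons take_0 not0_implies_Suc)

text \<open>After \<open>i\<close> is read, its lead of one is used up and the next letter of the
  pair must be \<open>j\<close>; the bounds on the rest are those of the swapped pair.\<close>

lemma precedes_Cons: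
  assumes "i \<noteq> j"
  shows "precedes (a # w) i j \<longleftrightarrow>
    (if a = i then precedes w j i else if a = j then False else precedes w i j)"
proof -
  have *: "precedes (a # w) i j \<longleftrightarrow>
     (\<forall>m. count_list (a # take m w) j \<le> count_list (a # take m w) i \<and>
          count_list (a # take m w) i \<le> count_list (a # take m w) j + 1)"
    unfolding precedes_def
    using all_nat_take_Cons[of "\<lambda>v. count_list v j \<le> count_list v i \<and>
      count_list v i \<le> count_list v j + 1" a w] by simp
  show ?thesis
  proof (cases "a = j")
    case True
    have "\<not> precedes (j # w) i j"
      unfolding precedes_def by (rule notI, drule spec[of _ 1]) (use assms in simp)
    then show ?thesis using assms True by simp
  next
    case False
    then show ?thesis using assms unfolding * by (auto simp: precedes_def)
  qed
qed

lemma restrict_word_commute: "restrict_word w i j = restrict_word w j i"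
  by (simp add: restrict_word_def disj_commute)

lemma hd_restrict_word: "restrict_word w i j = [] \<or> hd (restrict_word w i j) \<in> {i, j}"
  by (induction w) (auto simp: restrict_word_def)

lemma alternate_commute: "alternate w i j \<longleftrightarrow> alternate w j i"
  by (auto simp: alternate_def restrict_word_commute)

lemma sublist_same_Cons:
  "sublist [a, a] (b # v) \<longleftrightarrow> (b = a \<and> v \<noteq> [] \<and> hd v = a) \<or> sublist [a, a] v"
  by (cases v) (auto simp: sublist_Cons_right)

lemma precedes_iff_alternate_hd:
  assumes "i \<noteq> j"
  shows "precedes w i j \<longleftrightarrow>
    alternate w i j \<and> (restrict_word w i j = [] \<or> hd (restrict_word w i j) = i)"
  using assms
proof (induction w arbitrary: i j)
  case Nil
  then show ?case by (simp add: precedes_Nil alternate_def restrict_word_def)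
next
  case (Cons a w)
  note IH = Cons.IH[OF Cons.prems] Cons.IH[OF Cons.prems[symmetric]]
  note hd_cases = hd_restrict_word[of w i j]
  consider "a = i" | "a = j" "a \<noteq> i" | "a \<noteq> i" "a \<noteq> j" by blast
  then show ?case
  proof cases
    case 1
    then have "restrict_word (a # w) i j = i # restrict_word w i j"
      by (simp add: restrict_word_def)
    then show ?thesis using 1 Cons.prems IH(2) hd_cases
      by (auto simp: precedes_Cons alternate_def restrict_word_commute[of w j i] sublist_same_Cons)
  next
    case 2
    then have "restrict_word (a # w) i j = j # restrict_word w i j"
      by (simp add: restrict_word_def)
    then show ?thesis using 2 Cons.prems by (auto simp: precedes_Cons)
  next
    case 3
    then have "restrict_word (a # w) i j = restrict_word w i j"
      by (simp add: restrict_word_def)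
    then show ?thesis using 3 Cons.prems IH(1) by (simp add: precedes_Cons alternate_def)
  qed
qed

lemma alternate_iff_precedes:
  assumes "i \<noteq> j"
  shows "alternate w i j \<longleftrightarrow> precedes w i j \<or> precedes w j i"
proof -
  show ?thesis
    using assms hd_restrict_word[of w i j]
    by (auto simp: precedes_iff_alternate_hd restrict_word_commute[of w j i]
        alternate_commute[of w j i])
qed

section \<open>Semi-transitive orientations\<close>

definition adjacent :: "'a graph \<Rightarrow> 'a \<Rightarrow> 'a \<Rightarrow> bool" where
  "adjacent G u v \<longleftrightarrow> u \<in> verts G \<and> v \<in> verts G \<and> u \<noteq> v \<and> {u, v} \<in> edges G"

text \<open>\<open>L\<close> is the reachability preorder of the orientation; absence of shortcuts only
  involves reachability between the vertices concerned.\<close>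

locale semi_transitive =
  fixes E L :: "'a \<Rightarrow> 'a \<Rightarrow> bool"
  assumes sym: "E a b \<Longrightarrow> E b a"
    and total: "E a b \<Longrightarrow> L a b \<or> L b a"
    and asym: "E a b \<Longrightarrow> L a b \<Longrightarrow> \<not> L b a"
    and refl: "E a b \<Longrightarrow> L a a"
    and trans: "L a b \<Longrightarrow> L b c \<Longrightarrow> L a c"
    and no_shortcut: "E a d \<Longrightarrow> L a b \<Longrightarrow> L b c \<Longrightarrow> L c d \<Longrightarrow> b \<noteq> c \<Longrightarrow> E b c"
begin

lemma no_shortcut_left:
  assumes "E a d" "L a c" "L c d" "a \<noteq> c"
  shows "E a c"
  by (rule no_shortcut[OF assms(1) refl[OF assms(1)] assms(2-4)])

lemma no_shortcut_right:
  assumes "E a d" "L a b" "L b d" "b \<noteq> d"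
  shows "E b d"
  by (rule no_shortcut[OF assms(1-3) refl[OF sym[OF assms(1)]] assms(4)])

lemma reverse: "semi_transitive E (\<lambda>a b. L b a)"
proof
  fix a b c d
  show "E a b \<Longrightarrow> E b a" by (rule sym)
  show "E a b \<Longrightarrow> L b a \<or> L a b" using total by blast
  show "E a b \<Longrightarrow> L b a \<Longrightarrow> \<not> L a b" using asym by blast
  show "E a b \<Longrightarrow> L a a" by (rule refl)
  show "L b a \<Longrightarrow> L c b \<Longrightarrow> L c a" by (rule trans)
  show "E b c" if "E a d" "L b a" "L c b" "L d c" "b \<noteq> c"
    using no_shortcut[OF sym[OF that(1)] that(4,3,2)] that(5) sym by simp
qed

end

text \<open>If only \<open>j\<close> occurs in \<open>w\<close>, the restriction changes from a
  power of \<open>j\<close> to \<open>i\<close> followed by that power, so no new square arises. If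
  neither occurs, each is added once; if both occur, nothing is added.\<close>

lemma alternate_prepend_missing:
  assumes "i \<in> V" "j \<in> V" "i \<noteq> j" "set xs = V - set w" "distinct xs"
  shows "alternate (xs @ w) i j \<longleftrightarrow> alternate w i j"
proof -
  have missing: "alternate (xs @ w) i j \<longleftrightarrow> alternate w i j"
    if "i \<noteq> j" "i \<in> V" "j \<in> V" "i \<notin> set w" for i j
  proof (cases "j \<in> set w")
    case True
    have "i \<in> set xs" "j \<notin> set xs" using that True assms(4) by auto
    then obtain ys zs where xs': "xs = ys @ i # zs" "i \<notin> set ys" "i \<notin> set zs"
      using \<open>distinct xs\<close> by (metis distinct.simps(2) distinct_append not_distinct_conv_prefix split_list_first)
    have "filter (\<lambda>k. k = i \<or> k = j) ys = []" "filter (\<lambda>k. k = i \<or> k = j) zs = []"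
      using xs' \<open>j \<notin> set xs\<close> by (auto simp: filter_empty_conv)
    then have xs: "restrict_word xs i j = [i]"
      using xs' by (simp add: restrict_word_def)
    have w: "i \<notin> set (restrict_word w i j)" using that by (simp add: restrict_word_def)
    have "\<not> sublist [i, i] (restrict_word w i j)" "\<not> sublist [i, i] (i # restrict_word w i j)"
      using w by (auto simp: sublist_def Cons_eq_append_conv)
    then show ?thesis using xs \<open>i \<noteq> j\<close>
      by (auto simp: alternate_def restrict_word_def sublist_same_Cons)
  next
    case False
    have "distinct (restrict_word xs i j)" using \<open>distinct xs\<close> by (simp add: restrict_word_def)
    moreover have "restrict_word w i j = []" using that False
      by (auto simp: restrict_word_def filter_empty_conv)
    ultimately show ?thesis
      by (auto simp: alternate_def restrict_word_def sublist_def)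
  qed
  show ?thesis
  proof (cases "i \<in> set w \<and> j \<in> set w")
    case True
    then have "restrict_word xs i j = []" using assms(4)
      by (auto simp: restrict_word_def filter_empty_conv)
    then show ?thesis by (simp add: alternate_def restrict_word_def)
  next
    case False
    then show ?thesis using missing[of i j] missing[of j i] assms alternate_commute by metis
  qed
qed

text \<open>Letters absent from the word all have the same prefix counts, which would spoil
  antisymmetry of reachability; hence a word using every vertex.\<close>

lemma word_representable_full_word:
  assumes "word_representable G" "finite (verts G)"
  obtains w where "set w = verts G"
    "\<And>i j. i \<in> verts G \<Longrightarrow> j \<in> verts G \<Longrightarrow> i \<noteq> j \<Longrightarrow> {i, j} \<in> edges G \<longleftrightarrow> alternate w i j"
proof -
  obtain w where w: "w \<in> lists (verts G)" and
    alt: "\<And>i j. i \<in> verts G \<Longrightarrow> j \<in> verts G \<Longrightarrow> i \<noteq> j \<Longrightarrow> {i, j} \<in> edges G \<longleftrightarrow> alternate w i j"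
    using assms(1) unfolding word_representable_def by blast
  obtain xs where xs: "set xs = verts G - set w" "distinct xs"
    using assms(2) finite_distinct_list[of "verts G - set w"] by auto
  have "set (xs @ w) = verts G" using w xs by auto
  then show thesis
    using that[of "xs @ w"] alt alternate_prepend_missing[OF _ _ _ xs] by blast
qed

text \<open>At an occurrence of \<open>a\<close> only the count of the letter just read rises, and
  the count of \<open>b\<close> must rise with it.\<close>

lemma count_list_eq_all_prefixes:
  assumes "\<And>m. count_list (take m w) a = count_list (take m w) b" "a \<in> set w"
  shows "a = b"
proof -
  obtain ys zs where w: "w = ys @ a # zs" using assms(2) by (meson split_list)
  show ?thesis
    using assms(1)[of "length ys"] assms(1)[of "Suc (length ys)"]
    by (auto simp: w split: if_splits)
qed

text \<open>Reachability is domination of all prefix counts. On a chain \<open>a\<close>,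
  \<open>b\<close>, \<open>c\<close>, \<open>d\<close> with \<open>a\<close> and \<open>d\<close>
  alternating, the counts of \<open>b\<close> and \<open>c\<close> are squeezed between two counts
  that differ by at most one, so \<open>b\<close> and \<open>c\<close> alternate too.\<close>

lemma word_representable_semi_transitive:
  assumes "word_representable G" "finite (verts G)"
  shows "\<exists>L. semi_transitive (adjacent G) L"
proof -
  obtain w where w: "set w = verts G" and
    alt: "\<And>i j. i \<in> verts G \<Longrightarrow> j \<in> verts G \<Longrightarrow> i \<noteq> j \<Longrightarrow> {i, j} \<in> edges G \<longleftrightarrow> alternate w i j"
    using word_representable_full_word[OF assms] by blast
  let ?c = "\<lambda>m. count_list (take m w)"
  define L where "L a b \<longleftrightarrow> a \<in> verts G \<and> b \<in> verts G \<and> (\<forall>m. ?c m b \<le> ?c m a)" for a b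
  have adj: "adjacent G a b \<longleftrightarrow> a \<in> verts G \<and> b \<in> verts G \<and> a \<noteq> b \<and>
      (precedes w a b \<or> precedes w b a)" for a b
    using alt alternate_iff_precedes[of a b w] by (auto simp: adjacent_def)
  have antisym: "a = b" if "L a b" "L b a" for a b
  proof (rule count_list_eq_all_prefixes)
    show "?c m a = ?c m b" for m using that unfolding L_def by (meson order_antisym)
    show "a \<in> set w" using that w by (simp add: L_def)
  qed
  have "semi_transitive (adjacent G) L"
  proof
    fix a b c d
    show "adjacent G a b \<Longrightarrow> adjacent G b a" by (auto simp: adj)
    show "adjacent G a b \<Longrightarrow> L a b \<or> L b a" by (auto simp: adj L_def precedes_def)
    show "adjacent G a b \<Longrightarrow> L a b \<Longrightarrow> \<not> L b a" using antisym by (auto simp: adj)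
    show "adjacent G a b \<Longrightarrow> L a a" by (auto simp: adj L_def)
    show "L a b \<Longrightarrow> L b c \<Longrightarrow> L a c" unfolding L_def by (meson order_trans)
    assume *: "adjacent G a d" "L a b" "L b c" "L c d" "b \<noteq> c"
    have le: "?c m d \<le> ?c m c" "?c m c \<le> ?c m b" "?c m b \<le> ?c m a" for m
      using * by (auto simp: L_def)
    have "?c m a \<le> ?c m d + 1" for m
      using *(1) le[of m] unfolding adj precedes_def by (metis le_trans trans_le_add1)
    then have "precedes w b c" unfolding precedes_def using le by (meson add_mono le_trans order_refl)
    then show "adjacent G b c" using * by (auto simp: adj L_def)
  qed
  then show ?thesis by blast
qed

section \<open>Two hubs joined to a path\<close>

lemma alternating_parity:
  fixes c :: "nat \<Rightarrow> bool"
  assumes "\<And>i. 2 \<le> i \<Longrightarrow> i < 2 * n \<Longrightarrow> c (i + 1) \<longleftrightarrow> \<not> c i" "n \<ge> 1"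
  shows "c (2 * n) \<longleftrightarrow> c 2"
proof -
  have "2 + d \<le> 2 * n \<Longrightarrow> c (2 + d) \<longleftrightarrow> (c 2 \<longleftrightarrow> even d)" for d
  proof (induction d)
    case (Suc d)
    then show ?case using assms(1)[of "2 + d"] by auto
  qed simp
  moreover have "2 + (2 * n - 2) = 2 * n" "even (2 * n - 2)" using assms(2) by auto
  ultimately show ?thesis by (metis order_refl)
qed

text \<open>An abstract copy of the graph in which the hubs \<open>A\<close>, \<open>B\<close> are oriented \<open>A \<rightarrow> B\<close>. Reversing all
  arcs while reflecting the path is a symmetry (\<open>reflected\<close> below).\<close>

locale double_fan = semi_transitive E L for E L :: "'a \<Rightarrow> 'a \<Rightarrow> bool" +
  fixes A B x y :: 'a and p :: "nat \<Rightarrow> 'a" and n :: nat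
  assumes n: "n \<ge> 3"
    and hubs: "E A B" and hub_arc: "L A B"
    and A_path: "i \<in> {2..2*n} \<Longrightarrow> E A (p i)"
    and B_path: "i \<in> {2..2*n} \<Longrightarrow> E B (p i)"
    and path: "i \<in> {2..2*n} \<Longrightarrow> k \<in> {2..2*n} \<Longrightarrow> E (p i) (p k) \<longleftrightarrow> k = i + 1 \<or> i = k + 1"
    and inj: "inj_on p {2..2*n}"
    and x_edges: "E A x" "E (p (2*n)) x"
    and x_B: "\<not> E x B" "x \<noteq> B"
    and x_path: "i \<in> {2..2*n} \<Longrightarrow> x \<noteq> p i" "i \<in> {2..2*n} \<Longrightarrow> i \<noteq> 2*n \<Longrightarrow> \<not> E x (p i)"
    and y_edges: "E B y" "E (p 2) y"
    and y_A: "\<not> E y A" "y \<noteq> A"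
    and y_path: "i \<in> {2..2*n} \<Longrightarrow> y \<noteq> p i" "i \<in> {2..2*n} \<Longrightarrow> i \<noteq> 2 \<Longrightarrow> \<not> E y (p i)"
begin

lemma reflected: "double_fan E (\<lambda>a b. L b a) B A y x (\<lambda>i. p (2*n+2-i)) n"
proof -
  interpret R: semi_transitive E "\<lambda>a b. L b a" by (rule reverse)
  have mem: "2*n+2-i \<in> {2..2*n}" if "i \<in> {2..2*n}" for i using that by auto
  have end_iff: "2*n+2-i = 2 \<longleftrightarrow> i = 2*n" "2*n+2-i = 2*n \<longleftrightarrow> i = 2" if "i \<in> {2..2*n}" for i
    using that by auto
  have idx: "2*n+2-2*n = 2" "2*n+2-2 = 2*n" by auto
  show ?thesis
  proof
    show "n \<ge> 3" "E B A" "L A B" using n hubs hub_arc sym by auto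
    fix i k
    assume i: "i \<in> {2..2*n}"
    show "E B (p (2*n+2-i))" "E A (p (2*n+2-i))" using A_path B_path mem[OF i] by auto
    show "y \<noteq> p (2*n+2-i)" "x \<noteq> p (2*n+2-i)" using x_path y_path mem[OF i] by auto
    show "\<not> E y (p (2*n+2-i))" if "i \<noteq> 2*n"
      using y_path(2)[OF mem[OF i]] end_iff[OF i] that by blast
    show "\<not> E x (p (2*n+2-i))" if "i \<noteq> 2"
      using x_path(2)[OF mem[OF i]] end_iff[OF i] that by blast
    assume k: "k \<in> {2..2*n}"
    have "2*n+2-k = 2*n+2-i + 1 \<or> 2*n+2-i = 2*n+2-k + 1 \<longleftrightarrow> k = i + 1 \<or> i = k + 1"
      using i k unfolding atLeastAtMost_iff by linarith
    then show "E (p (2*n+2-i)) (p (2*n+2-k)) \<longleftrightarrow> k = i + 1 \<or> i = k + 1"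
      using path mem[OF i] mem[OF k] by metis
  next
    show "inj_on (\<lambda>i. p (2*n+2-i)) {2..2*n}"
    proof (rule inj_onI)
      fix i k assume "i \<in> {2..2*n}" "k \<in> {2..2*n}" "p (2*n+2-i) = p (2*n+2-k)"
      then have "2*n+2-i = 2*n+2-k" using inj mem by (auto dest: inj_onD)
      then show "i = k" using \<open>i \<in> _\<close> \<open>k \<in> _\<close> by auto
    qed
    show "E (p (2*n+2-2*n)) y" "E (p (2*n+2-2)) x" unfolding idx using y_edges x_edges by auto
  qed (use x_edges x_B y_edges y_A in auto)
qed

definition S :: "nat \<Rightarrow> bool" where "S i \<longleftrightarrow> L (p i) A"
definition T :: "nat \<Rightarrow> bool" where "T i \<longleftrightarrow> L B (p i)"
definition M :: "nat \<Rightarrow> bool" where "M i \<longleftrightarrow> L A (p i) \<and> L (p i) B"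
definition nb :: "nat \<Rightarrow> nat \<Rightarrow> bool" where
  "nb i k \<longleftrightarrow> i \<in> {2..2*n} \<and> k \<in> {2..2*n} \<and> (k = i + 1 \<or> i = k + 1)"

lemma nb_E: "nb i k \<Longrightarrow> E (p i) (p k)"
  using path by (auto simp: nb_def)

lemma nb_sym: "nb i k \<Longrightarrow> nb k i"
  by (auto simp: nb_def)

lemma path_no_triangle:
  assumes "nb i k" "nb k l" "i \<noteq> l"
  shows "\<not> E (p i) (p l)" "p i \<noteq> p l"
proof -
  have "i \<in> {2..2*n}" "l \<in> {2..2*n}" "\<not> (l = i + 1 \<or> i = l + 1)"
    using assms by (auto simp: nb_def)
  then show "\<not> E (p i) (p l)" "p i \<noteq> p l"
    using path inj_onD[OF inj] assms(3) by blast+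
qed

lemma S_B: "S i \<Longrightarrow> L (p i) B"
  using trans hub_arc by (auto simp: S_def)

lemma T_A: "T i \<Longrightarrow> L A (p i)"
  using trans hub_arc by (auto simp: T_def)

lemma S_or_T_or_M: "i \<in> {2..2*n} \<Longrightarrow> S i \<or> T i \<or> M i"
  using total A_path B_path by (auto simp: S_def T_def M_def)

lemma not_S_and_T: "i \<in> {2..2*n} \<Longrightarrow> S i \<Longrightarrow> \<not> T i"
  using asym A_path T_A by (auto simp: S_def)

lemma not_M_and_S: "i \<in> {2..2*n} \<Longrightarrow> M i \<Longrightarrow> \<not> S i"
  using asym A_path by (auto simp: S_def M_def)

text \<open>The outer vertices are not adjacent. If \<open>A\<close> came before \<open>p i\<close>,
  then \<open>p i\<close> would lie between the adjacent vertices \<open>A\<close> and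
  \<open>p l\<close>, forcing the missing edge. Dually with \<open>B\<close> at the other
  end.\<close>

lemma directed_two_path:
  assumes "nb i k" "nb k l" "i \<noteq> l" "L (p i) (p k)" "L (p k) (p l)"
  shows "S i" "T l"
proof -
  have il: "L (p i) (p l)" using assms trans by blast
  note N = path_no_triangle[OF assms(1-3)]
  have I: "i \<in> {2..2*n}" "l \<in> {2..2*n}" using assms by (auto simp: nb_def)
  have "\<not> L A (p i)"
    using no_shortcut_right[OF A_path[OF I(2)] _ il N(2)] N(1) by blast
  then show "S i" using total[OF A_path[OF I(1)]] by (simp add: S_def)
  have "\<not> L (p l) B"
    using no_shortcut_left[OF sym[OF B_path[OF I(1)]] il _ N(2)] N(1) by blast
  then show "T l" using total[OF B_path[OF I(2)]] by (simp add: T_def)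
qed

text \<open>A vertex before both hubs reaches \<open>p m\<close> through \<open>A\<close>, so
  \<open>p m\<close> lies inside its arc to \<open>B\<close>, which forces an edge. For a vertex
  after both hubs the arc from \<open>A\<close> serves.\<close>

lemma M_adjacent_non_M:
  assumes "M m" "\<not> M i" "m \<in> {2..2*n}" "i \<in> {2..2*n}"
  shows "nb m i"
proof -
  have ne: "p i \<noteq> p m" using assms by (metis inj inj_onD)
  have "E (p i) (p m)"
  proof (cases "S i")
    case True
    then have "L (p i) (p m)" using assms(1) trans by (auto simp: S_def M_def)
    then show ?thesis
      using no_shortcut_left[OF sym[OF B_path[OF assms(4)]] _ _ ne] assms(1) by (simp add: M_def)
  next
    case False
    then have "T i" using S_or_T_or_M assms by blast
    then have "L (p m) (p i)" using assms(1) trans by (auto simp: T_def M_def)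
    then show ?thesis
      using no_shortcut_right[OF A_path[OF assms(4)] _ _ ne[symmetric]] assms(1) sym
      by (simp add: M_def)
  qed
  then show ?thesis using path assms by (auto simp: nb_def)
qed

lemma all_M:
  assumes "M m" "m \<in> {2..2*n}" "i \<in> {2..2*n}"
  shows "M i"
proof (rule ccontr)
  assume "\<not> M i"
  then have mi: "nb m i" using M_adjacent_non_M assms by blast
  text \<open>The path has at least five vertices, so some \<open>k\<close> is far from both \<open>m\<close> and \<open>i\<close>.\<close>
  define k where "k = (if 3 < m \<and> 3 < i then 2 else 2*n)"
  have k: "k \<in> {2..2*n}" "\<not> nb m k" "\<not> nb k i"
    using mi n by (auto simp: k_def nb_def split: if_splits)
  then have "M k" using M_adjacent_non_M assms by blast
  then show False using M_adjacent_non_M k assms \<open>\<not> M i\<close> by blast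
qed

text \<open>An arc from \<open>?f\<close> to \<open>?e\<close> leaves no place for \<open>x\<close>.
  From \<open>A\<close> through \<open>x\<close> to \<open>?e\<close>, \<open>x\<close> falls
  between the hubs; with \<open>x\<close> before \<open>A\<close> and \<open>?e\<close>,
  \<open>?f\<close> falls between \<open>x\<close> and \<open>?e\<close>; with \<open>x\<close>
  after \<open>?e\<close>, \<open>?f\<close> falls between \<open>A\<close> and \<open>x\<close>.
  Each needs an edge that \<open>x\<close> lacks, and \<open>?e\<close> before \<open>x\<close>
  before \<open>A\<close> closes a cycle.\<close>

lemma M_end_not_sink:
  assumes "M (2*n)" "M (2*n-1)"
  shows "\<not> L (p (2*n-1)) (p (2*n))"
proof
  let ?e = "p (2*n)" and ?f = "p (2*n-1)"
  assume fe: "L ?f ?e"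
  have I: "2*n \<in> {2..2*n}" "2*n-1 \<in> {2..2*n}" "2*n-1 \<noteq> 2*n" using n by auto
  have M: "L A ?e" "L ?e B" "L A ?f" "L ?f B" using assms by (auto simp: M_def)
  note nx = x_path(1)[OF I(2)] x_path(2)[OF I(2,3)]
  consider "L A x" "L x ?e" | "L x A" | "L ?e x"
    using total x_edges by blast
  then show False
  proof cases
    case 1
    then have "L x B" using M trans by blast
    then show False using no_shortcut_right[OF hubs 1(1) _ x_B(2)] x_B(1) by blast
  next
    case 2
    show False
    proof (cases "L x ?e")
      case True
      have "L x ?f" using 2 M trans by blast
      then show False using no_shortcut_left[OF sym[OF x_edges(2)] _ fe nx(1)] nx(2) by blast
    next
      case False
      then have "L ?e x" using total x_edges by blast
      then have "L ?e A" using 2 trans by blast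
      then show False using asym[OF A_path[OF I(1)]] M by blast
    qed
  next
    case 3
    have "L ?f x" using fe 3 trans by blast
    then show False using no_shortcut_right[OF x_edges(1) M(3) _ nx(1)[symmetric]] nx(2) sym by blast
  qed
qed

text \<open>Given an arc from \<open>?e\<close> to \<open>?f\<close>: if \<open>x\<close> is between
  \<open>?e\<close> and \<open>A\<close>, it is also between \<open>?e\<close> and \<open>B\<close>;
  if before both, \<open>?f\<close> is between \<open>x\<close> and \<open>A\<close>; if after
  \<open>A\<close>, \<open>?f\<close> is between \<open>?e\<close> and \<open>x\<close>.\<close>

lemma S_end_sink:
  assumes "S (2*n)" "S (2*n-1)"
  shows "\<not> L (p (2*n)) (p (2*n-1))"
proof
  let ?e = "p (2*n)" and ?f = "p (2*n-1)"
  assume ef: "L ?e ?f"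
  have I: "2*n \<in> {2..2*n}" "2*n-1 \<in> {2..2*n}" "2*n-1 \<noteq> 2*n" using n by auto
  have S: "L ?e A" "L ?f A" using assms by (auto simp: S_def)
  note nx = x_path(1)[OF I(2)] x_path(2)[OF I(2,3)]
  consider "L ?e x" "L x A" | "L x ?e" "L x A" | "L A x"
    using total x_edges by blast
  then show False
  proof cases
    case 1
    then have "L x B" using hub_arc trans by blast
    then show False
      using no_shortcut_right[OF sym[OF B_path[OF I(1)]] 1(1) _ x_B(2)] x_B(1) by blast
  next
    case 2
    then have "L x ?f" using ef trans by blast
    then show False using no_shortcut_left[OF sym[OF x_edges(1)] _ S(2) nx(1)] nx(2) by blast
  next
    case 3
    then have "L ?f x" using S trans by blast
    then show False using no_shortcut_right[OF x_edges(2) ef _ nx(1)[symmetric]] nx(2) sym by blast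
  qed
qed

text \<open>The place of \<open>x\<close> is forced: before \<open>A\<close> it would put
  \<open>B\<close> between \<open>x\<close> and \<open>?e\<close>, after \<open>?e\<close> it would
  put \<open>B\<close> between \<open>A\<close> and \<open>x\<close>. So \<open>x\<close> lies
  between \<open>A\<close> and \<open>?e\<close>. Then \<open>S\<close> at \<open>?f\<close> puts
  \<open>x\<close> between \<open>?f\<close> and \<open>?e\<close>, and an arc from
  \<open>?e\<close> to \<open>?f\<close> puts \<open>x\<close> between \<open>A\<close> and
  \<open>?f\<close>.\<close>

lemma T_end_sink:
  assumes "T (2*n)" "S (2*n-1) \<or> T (2*n-1)"
  shows "T (2*n-1) \<and> L (p (2*n-1)) (p (2*n))"
proof -
  let ?e = "p (2*n)" and ?f = "p (2*n-1)"
  have I: "2*n \<in> {2..2*n}" "2*n-1 \<in> {2..2*n}" "2*n-1 \<noteq> 2*n" using n by auto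
  have Ae: "L A ?e" "L B ?e" using assms T_A by (auto simp: T_def)
  have fe: "E ?f ?e" using path I by auto
  note nx = x_path(1)[OF I(2)] x_path(2)[OF I(2,3)]
  have "\<not> L x A"
  proof
    assume "L x A"
    then have "L x B" using hub_arc trans by blast
    then show False using no_shortcut_left[OF sym[OF x_edges(2)] _ Ae(2) x_B(2)] x_B(1) by blast
  qed
  then have Ax: "L A x" using total x_edges by blast
  have "\<not> L ?e x"
  proof
    assume "L ?e x"
    then have "L B x" using Ae trans by blast
    then show False
      using no_shortcut_right[OF x_edges(1) hub_arc _ x_B(2)[symmetric]] x_B(1) sym by blast
  qed
  then have xe: "L x ?e" using total x_edges by blast
  have "\<not> S (2*n-1)"
  proof
    assume "S (2*n-1)"
    then have "L ?f x" using Ax trans by (auto simp: S_def)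
    then show False using no_shortcut_left[OF fe _ xe nx(1)[symmetric]] nx(2) sym by blast
  qed
  then have T: "T (2*n-1)" using assms by blast
  have "\<not> L ?e ?f"
  proof
    assume "L ?e ?f"
    then have "L x ?f" using xe trans by blast
    then show False
      using no_shortcut_right[OF A_path[OF I(2)] Ax _ nx(1)] nx(2) by blast
  qed
  then show ?thesis using T total[OF fe] by blast
qed

lemma inconsistent_M:
  assumes "M m" "m \<in> {2..2*n}"
  shows False
proof -
  interpret R: double_fan E "\<lambda>a b. L b a" B A y x "\<lambda>i. p (2*n+2-i)" n
    by (rule reflected)
  \<comment> \<open>A directed two-path would begin at a vertex of type \<open>S\<close>, so every
    path vertex is a source or a sink of the path, and \<open>c\<close> marks the sinks.\<close>
  define c where "c i \<longleftrightarrow> (\<exists>k. nb k i \<and> L (p k) (p i))" for i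
  have M: "M i" if "i \<in> {2..2*n}" for i using all_M assms that by blast
  have alternating: "c (i + 1) \<longleftrightarrow> \<not> c i" if "2 \<le> i" "i < 2*n" for i
  proof -
    have nb: "nb i (i + 1)" using that by (auto simp: nb_def)
    have two: False if "nb j k" "nb k l" "j \<noteq> l" "L (p j) (p k)" "L (p k) (p l)" for j k l
      using directed_two_path(1)[OF that] M not_M_and_S that(1) by (auto simp: nb_def)
    have one: "\<not> c u" if "nb u v" "L (p u) (p v)" for u v
    proof
      assume "c u"
      then obtain k where k: "nb k u" "L (p k) (p u)" by (auto simp: c_def)
      then have "k \<noteq> v" using asym[OF nb_E[OF that(1)]] that by blast
      then show False using two k that by blast
    qed
    show ?thesis
    proof (cases "L (p i) (p (i + 1))")
      case True
      then show ?thesis using one nb by (auto simp: c_def)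
    next
      case False
      then have "L (p (i + 1)) (p i)" using total nb_E[OF nb] by blast
      then show ?thesis using one nb nb_sym by (auto simp: c_def)
    qed
  qed
  have last: "\<not> c (2*n)"
  proof
    assume "c (2*n)"
    moreover have "nb k (2*n) \<Longrightarrow> k = 2*n-1" for k by (auto simp: nb_def)
    ultimately have "L (p (2*n-1)) (p (2*n))" by (auto simp: c_def)
    moreover have "2*n-1 \<in> {2..2*n}" "2*n \<in> {2..2*n}" using n by auto
    ultimately show False using M_end_not_sink M by blast
  qed
  have "c 2"
  proof -
    \<comment> \<open>In the reflected copy the end statement concerns \<open>2\<close> and
      \<open>3\<close> with arcs reversed: \<open>2\<close> is not a source, hence a sink.\<close>
    have idx: "2*n+2-2*n = 2" "2*n+2-(2*n-1) = 3" using n by auto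
    have "R.M (2*n)" "R.M (2*n-1)"
      unfolding R.M_def idx using M[of 2] M[of 3] n by (auto simp: M_def)
    then have "\<not> L (p 2) (p 3)"
      using R.M_end_not_sink unfolding idx by blast
    moreover have nb: "nb 3 2" using n by (auto simp: nb_def)
    ultimately have "L (p 3) (p 2)" using total nb_E by blast
    then show ?thesis using nb by (auto simp: c_def)
  qed
  then show False using alternating_parity[of n c] alternating n last by simp
qed

lemma inconsistent_no_M:
  assumes no_M: "\<And>i. i \<in> {2..2*n} \<Longrightarrow> \<not> M i"
  shows False
proof -
  interpret R: double_fan E "\<lambda>a b. L b a" B A y x "\<lambda>i. p (2*n+2-i)" n
    by (rule reflected)
  have ST: "S i \<or> T i" if "i \<in> {2..2*n}" for i using S_or_T_or_M no_M that by blast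
  text \<open>Inside a run of equal type, \<open>c\<close> says that a vertex is a sink of the run; the vertices
    where a run of \<open>S\<close> (of \<open>T\<close>) meets another run are always sinks (sources) of it, which fixes the
    value on runs of length one.\<close>
  define c where "c i \<longleftrightarrow> (S i \<and> \<not> (\<exists>k. nb i k \<and> S k \<and> L (p i) (p k))) \<or>
    (T i \<and> (\<exists>k. nb k i \<and> T k \<and> L (p k) (p i)))" for i
  \<comment> \<open>From \<open>p i\<close> to \<open>p k\<close> one passes both hubs. A further
    \<open>S\<close> neighbour after \<open>p i\<close>, or a further \<open>T\<close> neighbour
    before \<open>p k\<close>, would lie inside this arc and close a triangle on the path.\<close>
  have S_T: "c i \<and> \<not> c k" if "S i" "T k" "nb i k" for i k
  proof -
    have I: "i \<in> {2..2*n}" "k \<in> {2..2*n}" using that(3) by (auto simp: nb_def)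
    have no_T: "\<not> T i" "\<not> S k" using that I not_S_and_T by auto
    have "\<not> (nb i l \<and> S l \<and> L (p i) (p l))" for l
    proof
      assume l: "nb i l \<and> S l \<and> L (p i) (p l)"
      then have lk: "l \<noteq> k" using no_T by blast
      note N = path_no_triangle[OF nb_sym[of i l] that(3) lk]
      have "L (p l) (p k)" using l T_A[OF that(2)] trans by (auto simp: S_def)
      then show False using no_shortcut_right[OF nb_E[OF that(3)]] l N by blast
    qed
    moreover have "\<not> (nb l k \<and> T l \<and> L (p l) (p k))" for l
    proof
      assume l: "nb l k \<and> T l \<and> L (p l) (p k)"
      then have lk: "i \<noteq> l" using no_T by blast
      note N = path_no_triangle[OF that(3) nb_sym[of l k] lk]
      have "L (p i) (p l)" using l S_B[OF that(1)] trans by (auto simp: T_def)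
      then show False using no_shortcut_left[OF nb_E[OF that(3)]] l N by blast
    qed
    ultimately show ?thesis using that no_T by (auto simp: c_def)
  qed
  \<comment> \<open>Another arc out of \<open>p k\<close> inside the run would complete a directed
    two-path, whose last vertex has type \<open>T\<close>.\<close>
  have S_S: "\<not> c i \<and> c k" if "S i" "S k" "nb i k" "L (p i) (p k)" for i k
  proof -
    have I: "i \<in> {2..2*n}" "k \<in> {2..2*n}" using that(3) by (auto simp: nb_def)
    have "\<not> (nb k l \<and> S l \<and> L (p k) (p l))" for l
    proof
      assume l: "nb k l \<and> S l \<and> L (p k) (p l)"
      then have "i \<noteq> l" using asym[OF nb_E[OF that(3)]] that by blast
      then have "T l" using directed_two_path(2) that l by blast
      then show False using l not_S_and_T by (auto simp: nb_def)
    qed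
    then show ?thesis using that I not_S_and_T by (auto simp: c_def)
  qed
  have T_T: "\<not> c i \<and> c k" if "T i" "T k" "nb i k" "L (p i) (p k)" for i k
  proof -
    have I: "i \<in> {2..2*n}" "k \<in> {2..2*n}" using that(3) by (auto simp: nb_def)
    have "\<not> (nb l i \<and> T l \<and> L (p l) (p i))" for l
    proof
      assume l: "nb l i \<and> T l \<and> L (p l) (p i)"
      then have "l \<noteq> k" using asym[OF nb_E[OF that(3)]] that by blast
      then have "S l" using directed_two_path(1) that l by blast
      then show False using l not_S_and_T by (auto simp: nb_def)
    qed
    then show ?thesis using that I not_S_and_T by (auto simp: c_def)
  qed
  have alternating: "c (i + 1) \<longleftrightarrow> \<not> c i" if "2 \<le> i" "i < 2*n" for i
  proof -
    have nb: "nb i (i + 1)" using that by (auto simp: nb_def)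
    then have "S i \<or> T i" "S (i+1) \<or> T (i+1)" "L (p i) (p (i+1)) \<or> L (p (i+1)) (p i)"
      using ST total nb_E by (auto simp: nb_def)
    then show ?thesis using S_T S_S T_T nb nb_sym by blast
  qed
  have I: "2*n \<in> {2..2*n}" "2*n-1 \<in> {2..2*n}" "2 \<in> {2..2*n}" "3 \<in> {2..2*n}" using n by auto
  have last: "c (2*n)"
  proof (cases "S (2*n)")
    case True
    moreover have "nb (2*n) k \<Longrightarrow> k = 2*n-1" for k by (auto simp: nb_def)
    ultimately show ?thesis using S_end_sink unfolding c_def by blast
  next
    case False
    moreover have "nb (2*n-1) (2*n)" using I by (auto simp: nb_def)
    ultimately show ?thesis using T_end_sink ST I unfolding c_def by blast
  qed
  have idx: "2*n+2-2*n = 2" "2*n+2-(2*n-1) = 3" using n by auto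
  have RS: "R.S (2*n) \<longleftrightarrow> T 2" "R.S (2*n-1) \<longleftrightarrow> T 3" "R.T (2*n) \<longleftrightarrow> S 2" "R.T (2*n-1) \<longleftrightarrow> S 3"
    unfolding R.S_def T_def R.T_def S_def idx by (rule HOL.refl)+
  \<comment> \<open>Reflection exchanges \<open>S\<close> with \<open>T\<close> and reverses arcs,
    so the lemmas used for \<open>2n\<close> give the opposite colour at \<open>2\<close>.\<close>
  have "\<not> c 2"
  proof (cases "T 2")
    case True
    moreover have "nb k 2 \<Longrightarrow> k = 3" for k by (auto simp: nb_def)
    ultimately show ?thesis
      using R.S_end_sink[unfolded RS idx] not_S_and_T I unfolding c_def by blast
  next
    case False
    moreover have "nb 2 3" using I by (auto simp: nb_def)
    ultimately show ?thesis
      using R.T_end_sink[unfolded RS idx] ST I unfolding c_def by blast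
  qed
  then show False using alternating_parity[of n c] alternating n last by simp
qed

lemma inconsistent: False
  using inconsistent_M inconsistent_no_M by blast

end

section \<open>The graph itself\<close>

lemma G4_verts:
  "N i \<in> verts (G4 n) \<longleftrightarrow> 1 \<le> i \<and> i \<le> 2*n+1" "X \<in> verts (G4 n)" "Y \<in> verts (G4 n)"
  by (auto simp: G4_def)

lemma G4_edges_N:
  "{N i, N k} \<in> edges (G4 n) \<longleftrightarrow>
    (2 \<le> i \<and> i \<le> 2*n-1 \<and> k = i+1) \<or> (2 \<le> k \<and> k \<le> 2*n-1 \<and> i = k+1) \<or>
    (i = 1 \<and> 2 \<le> k \<and> k \<le> 2*n) \<or> (k = 1 \<and> 2 \<le> i \<and> i \<le> 2*n) \<or>
    (i = 2*n+1 \<and> 2 \<le> k \<and> k \<le> 2*n) \<or> (k = 2*n+1 \<and> 2 \<le> i \<and> i \<le> 2*n) \<or>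
    (i = 1 \<and> k = 2*n+1) \<or> (k = 1 \<and> i = 2*n+1)"
proof -
  have family: "{N i, N k} \<in> {{N (f l), N (g l)} | l. P l} \<longleftrightarrow>
      (\<exists>l. P l \<and> i = f l \<and> k = g l) \<or> (\<exists>l. P l \<and> i = g l \<and> k = f l)"
    for f g :: "nat \<Rightarrow> nat" and P
    by (auto simp: doubleton_eq_iff)
  have one_point: "(\<exists>l. P l \<and> a = c \<and> b = l) \<longleftrightarrow> a = c \<and> P b"
    "(\<exists>l. P l \<and> a = l \<and> b = c) \<longleftrightarrow> b = c \<and> P a"
    "(\<exists>l. P l \<and> a = l \<and> b = l + 1) \<longleftrightarrow> P a \<and> b = a + 1"
    "(\<exists>l. P l \<and> a = l + 1 \<and> b = l) \<longleftrightarrow> P b \<and> a = b + 1"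
    for a b c :: nat and P
    by auto
  have hub: "{N i, N k} \<in> {{N 1, N (2*n+1)}} \<longleftrightarrow> (i = 1 \<and> k = 2*n+1) \<or> (k = 1 \<and> i = 2*n+1)"
    "{N i, N k} \<notin> {{N 1, X}, {N (2*n), X}, {N 2, Y}, {N (2*n+1), Y}}"
    by (auto simp: doubleton_eq_iff)
  show ?thesis
    unfolding G4_def graph.sel Un_iff family one_point by (simp only: hub conj_ac disj_ac simp_thms)
qed

lemma G4_edges_path:
  assumes "i \<in> {2..2*n}" "k \<in> {2..2*n}"
  shows "{N i, N k} \<in> edges (G4 n) \<longleftrightarrow> k = i + 1 \<or> i = k + 1"
  using assms unfolding G4_edges_N atLeastAtMost_iff by linarith

lemma G4_edges_hubs:
  assumes "i \<in> {2..2*n}"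
  shows "{N 1, N i} \<in> edges (G4 n)" "{N (2*n+1), N i} \<in> edges (G4 n)"
    "{N 1, N (2*n+1)} \<in> edges (G4 n)"
  using assms unfolding G4_edges_N atLeastAtMost_iff by blast+

lemma G4_edges_XY:
  "{N i, X} \<in> edges (G4 n) \<longleftrightarrow> i = 1 \<or> i = 2*n"
  "{N i, Y} \<in> edges (G4 n) \<longleftrightarrow> i = 2 \<or> i = 2*n+1"
  "{X, N i} \<in> edges (G4 n) \<longleftrightarrow> i = 1 \<or> i = 2*n"
  "{Y, N i} \<in> edges (G4 n) \<longleftrightarrow> i = 2 \<or> i = 2*n+1"
  "{X, Y} \<notin> edges (G4 n)"
  by (auto simp: G4_def doubleton_eq_iff)

lemma G4_not_word_representable:
  assumes "n \<ge> 3"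
  shows "\<not> word_representable (G4 n)"
proof
  assume "word_representable (G4 n)"
  moreover have "finite (verts (G4 n))" by (simp add: G4_def)
  ultimately obtain L where L: "semi_transitive (adjacent (G4 n)) L"
    using word_representable_semi_transitive by blast
  let ?E = "adjacent (G4 n)" and ?A = "N 1" and ?B = "N (2*n+1)"
  have oriented: False if "semi_transitive ?E L" and hub_arc: "L ?A ?B" for L
  proof -
    interpret semi_transitive ?E L by (rule that(1))
    have "double_fan ?E L ?A ?B X Y N n"
    proof
      show "L ?A ?B" by (rule hub_arc)
      show "n \<ge> 3" by (rule assms)
      show "inj_on N {2..2*n}" by (simp add: inj_on_def)
      have ends: "2 \<in> {2..2*n}" "2*n \<in> {2..2*n}" using assms by auto
      have V: "?A \<in> verts (G4 n)" "?B \<in> verts (G4 n)" "X \<in> verts (G4 n)" "Y \<in> verts (G4 n)"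
        by (simp_all add: G4_verts)
      have VN: "N i \<in> verts (G4 n)" if "i \<in> {2..2*n}" for i
        using that by (simp add: G4_verts)
      show "?E ?A ?B" using V assms G4_edges_hubs(3)[OF ends(1)] by (simp add: adjacent_def)
      show "?E ?A X" "?E (N (2*n)) X" "\<not> ?E X ?B" "X \<noteq> ?B" "?E ?B Y" "?E (N 2) Y" "\<not> ?E Y ?A" "Y \<noteq> ?A"
        using V VN[OF ends(1)] VN[OF ends(2)] assms by (simp_all add: adjacent_def G4_edges_XY)
      fix i k
      assume i: "i \<in> {2..2*n}"
      show "?E ?A (N i)" "?E ?B (N i)"
        using V VN[OF i] i G4_edges_hubs[OF i] by (auto simp: adjacent_def)
      show "X \<noteq> N i" "Y \<noteq> N i" by simp_all
      show "\<not> ?E X (N i)" if "i \<noteq> 2*n" using that i by (simp add: adjacent_def G4_edges_XY)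
      show "\<not> ?E Y (N i)" if "i \<noteq> 2" using that i by (simp add: adjacent_def G4_edges_XY)
      assume k: "k \<in> {2..2*n}"
      show "?E (N i) (N k) \<longleftrightarrow> k = i + 1 \<or> i = k + 1"
        using G4_edges_path[OF i k] VN[OF i] VN[OF k] by (auto simp: adjacent_def)
    qed
    then show False by (rule double_fan.inconsistent)
  qed
  have "?E ?A ?B" using assms G4_edges_hubs(3)[of 2 n] by (simp add: adjacent_def G4_verts)
  then have "L ?A ?B \<or> L ?B ?A" using semi_transitive.total[OF L] by blast
  \<comment> \<open>If the hub edge points the other way, all arcs are reversed while every vertex
    stays in place.\<close>
  then show False using oriented L semi_transitive.reverse[OF L] by blast
qed

section \<open>Words given by occurrence times\<close>

text \<open>\<open>t u p\<close> is the time of occurrence \<open>p\<close> of \<open>u\<close>,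
  counted from 0; the condition is the pattern u v u v ... u v with \<open>k\<close> occurrences of
  each.\<close>

definition interleaved :: "nat \<Rightarrow> ('a \<Rightarrow> nat \<Rightarrow> 'b::linorder) \<Rightarrow> 'a \<Rightarrow> 'a \<Rightarrow> bool" where
  "interleaved k t u v \<longleftrightarrow>
     (\<forall>p<k. t u p < t v p \<and> (p + 1 < k \<longrightarrow> t v p < t u (p + 1)))"

text \<open>The word lists all times in increasing order, each replaced by its owner
  \<open>g\<close>, unique by \<open>inj\<close>. Prefixes then correspond to initial segments of
  times, so prefix counts can be compared at any chosen time.\<close>

lemma word_representable_timed:
  fixes t :: "'a \<Rightarrow> nat \<Rightarrow> 'b::linorder"
  assumes fin: "finite (verts G)"
    and mono: "\<And>v p. v \<in> verts G \<Longrightarrow> p + 1 < k \<Longrightarrow> t v p < t v (p + 1)"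
    and inj: "\<And>u v p q. u \<in> verts G \<Longrightarrow> v \<in> verts G \<Longrightarrow> u \<noteq> v \<Longrightarrow> p < k \<Longrightarrow> q < k \<Longrightarrow> t u p \<noteq> t v q"
    and edges: "\<And>u v. u \<in> verts G \<Longrightarrow> v \<in> verts G \<Longrightarrow> u \<noteq> v \<Longrightarrow>
      {u, v} \<in> edges G \<longleftrightarrow> interleaved k t u v \<or> interleaved k t v u"
  shows "word_representable G"
proof -
  have less: "t v p < t v q" if "v \<in> verts G" "p < q" "q < k" for v p q
    using that(2,3)
  proof (induction q)
    case (Suc q)
    then show ?case using mono[OF that(1), of q] less_trans by (cases "p = q") auto
  qed simp
  then have less_iff: "t v p < t v q \<longleftrightarrow> p < q" and le_iff: "t v p \<le> t v q \<longleftrightarrow> p \<le> q"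
    if "v \<in> verts G" "p < k" "q < k" for v p q
    using that by (metis linorder_neqE_nat order_less_asym order_less_irrefl)
      (use that less in \<open>metis linorder_not_less nat_less_le order_le_less\<close>)
  define D where "D = (\<Union>v\<in>verts G. t v ` {..<k})"
  define g where "g \<tau> = (SOME v. v \<in> verts G \<and> \<tau> \<in> t v ` {..<k})" for \<tau>
  have g: "g (t v p) = v" if "v \<in> verts G" "p < k" for v p
  proof -
    have "t v p \<in> t v ` {..<k}" using that by blast
    then have "g (t v p) \<in> verts G \<and> t v p \<in> t (g (t v p)) ` {..<k}"
      unfolding g_def using that(1) by (metis (mono_tags, lifting) someI_ex)
    then show ?thesis using inj[of "g (t v p)" v] that by fastforce
  qed
  define ts where "ts = sorted_list_of_set D"
  have ts: "set ts = D" "sorted ts" "distinct ts"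
    using fin by (auto simp: ts_def D_def)
  define w where "w = map g ts"
  have count: "count_list (take m w) u = card {p. p < k \<and> t u p \<in> set (take m ts)}"
    if u: "u \<in> verts G" for m u
  proof -
    have "count_list (take m w) u = length (filter (\<lambda>\<tau>. g \<tau> = u) (take m ts))"
      by (simp add: w_def take_map count_list_eq_length_filter filter_map comp_def eq_commute)
    also have "\<dots> = card {\<tau> \<in> set (take m ts). g \<tau> = u}"
      using ts(3) by (simp add: distinct_length_filter distinct_take Int_def conj_commute)
    also have "{\<tau> \<in> set (take m ts). g \<tau> = u} = t u ` {p. p < k \<and> t u p \<in> set (take m ts)}"
    proof -
      have "\<tau> \<in> t u ` {p. p < k \<and> t u p \<in> set (take m ts)}"
        if "\<tau> \<in> set (take m ts)" "g \<tau> = u" for \<tau>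
      proof -
        have "\<tau> \<in> D" using that ts set_take_subset by fast
        then obtain v p where "v \<in> verts G" "p < k" "\<tau> = t v p" by (auto simp: D_def)
        moreover from this have "v = u" using g that(2) by simp
        ultimately show ?thesis using that(1) by blast
      qed
      then show ?thesis using g u by auto
    qed
    also have "card \<dots> = card {p. p < k \<and> t u p \<in> set (take m ts)}"
      by (rule card_image) (metis (mono_tags, lifting) inj_onI mem_Collect_eq less u
          linorder_neqE_nat order_less_irrefl)
    finally show ?thesis .
  qed
  have prefix_closed: "b \<in> set (take m ts)" if "a \<in> set (take m ts)" "b \<in> D" "b \<le> a" for a b m
  proof (rule ccontr)
    assume "b \<notin> set (take m ts)"
    moreover have "set ts = set (take m ts) \<union> set (drop m ts)"
      by (metis append_take_drop_id set_append)
    ultimately have "b \<in> set (drop m ts)" using that(2) ts(1) by blast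
    moreover have "sorted (take m ts @ drop m ts)" using ts(2) by simp
    ultimately have "a \<le> b" using that(1) unfolding sorted_append by blast
    then show False using that \<open>b \<notin> _\<close> by auto
  qed
  have prefix_upto: "\<exists>m. set (take m ts) = {b \<in> D. b \<le> a}" if "a \<in> D" for a
  proof -
    have "a \<in> set ts" using that ts(1) by simp
    then obtain ys zs where eq: "ts = ys @ a # zs" by (meson split_list)
    note ts' = ts[unfolded eq]
    have "b \<in> set (ys @ [a]) \<longleftrightarrow> b \<in> D \<and> b \<le> a" for b
    proof -
      have "b \<in> D \<longleftrightarrow> b \<in> set (ys @ [a]) \<or> b \<in> set zs" using ts'(1) by auto
      moreover have "b \<le> a" if "b \<in> set (ys @ [a])" using that ts'(2) by (auto simp: sorted_append)
      moreover have "a < b" if "b \<in> set zs"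
        using that ts'(2,3) by (auto simp: sorted_append order_less_le)
      ultimately show ?thesis by (meson leD)
    qed
    moreover have "take (length ys + 1) ts = ys @ [a]" by (simp add: eq)
    ultimately have "set (take (length ys + 1) ts) = {b \<in> D. b \<le> a}" by auto
    then show ?thesis by (rule exI)
  qed
  have precedes: "precedes w u v \<longleftrightarrow> interleaved k t u v"
    if u: "u \<in> verts G" and v: "v \<in> verts G" and ne: "u \<noteq> v" for u v
  proof
    assume I: "interleaved k t u v"
    show "precedes w u v"
      unfolding precedes_def
    proof (intro allI conjI)
      fix m
      let ?P = "\<lambda>u. {p. p < k \<and> t u p \<in> set (take m ts)}"
      have tD: "t u p \<in> D" "t v p \<in> D" if "p < k" for p using u v that by (auto simp: D_def)
      have "?P v \<subseteq> ?P u"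
      proof
        fix p assume p: "p \<in> ?P v"
        then have "t u p \<le> t v p" using I by (auto simp: interleaved_def)
        then show "p \<in> ?P u" using prefix_closed[OF _ tD(1)] p by blast
      qed
      then show "count_list (take m w) v \<le> count_list (take m w) u"
        using count u v by (simp add: card_mono)
      \<comment> \<open>Occurrence \<open>q + 1\<close> of \<open>u\<close> comes after occurrence
        \<open>q\<close> of \<open>v\<close>; only occurrence 0 has no such partner, which accounts
        for the lead of one.\<close>
      have "?P u \<subseteq> insert 0 (Suc ` ?P v)"
      proof
        fix p assume p: "p \<in> ?P u"
        show "p \<in> insert 0 (Suc ` ?P v)"
        proof (cases p)
          case (Suc q)
          then have q: "q < k" using p by simp
          then have "t v q \<le> t u p" using I p Suc by (auto simp: interleaved_def intro: less_imp_le)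
          then have "q \<in> ?P v" using prefix_closed[OF _ tD(2)[OF q]] p q by blast
          then show ?thesis using Suc by blast
        qed simp
      qed
      then have "card (?P u) \<le> card (insert 0 (Suc ` ?P v))"
        by (rule card_mono[rotated]) simp
      also have "\<dots> \<le> Suc (card (?P v))"
        using card_image_le[of "?P v" Suc] by (simp add: card_insert_if)
      finally show "count_list (take m w) u \<le> count_list (take m w) v + 1"
        using count u v by simp
    qed
  next
    assume R: "precedes w u v"
    have upto: "count_list (take m w) a = card {p. p < k \<and> t a p \<le> \<tau>}"
      if m: "set (take m ts) = {b \<in> D. b \<le> \<tau>}" and a: "a \<in> verts G" for m a \<tau>
    proof -
      have "t a p \<in> D" if "p < k" for p using a that by (auto simp: D_def)
      then have "{p. p < k \<and> t a p \<in> set (take m ts)} = {p. p < k \<and> t a p \<le> \<tau>}"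
        unfolding m by blast
      then show ?thesis using count[OF a] by simp
    qed
    have self: "{q. q < k \<and> t a q \<le> t a p} = {..p}" if "a \<in> verts G" "p < k" for a p
      using le_iff[OF that(1) _ that(2)] that(2) by auto
    have R': "card {p. p < k \<and> t v p \<le> \<tau>} \<le> card {p. p < k \<and> t u p \<le> \<tau>} \<and>
      card {p. p < k \<and> t u p \<le> \<tau>} \<le> card {p. p < k \<and> t v p \<le> \<tau>} + 1"
      if \<tau>: "\<tau> \<in> D" for \<tau>
    proof -
      obtain m where m: "set (take m ts) = {b \<in> D. b \<le> \<tau>}" using prefix_upto[OF \<tau>] by blast
      show ?thesis using R[unfolded precedes_def] unfolding upto[OF m u, symmetric] upto[OF m v, symmetric] by blast
    qed
    show "interleaved k t u v"
      unfolding interleaved_def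
    proof (intro allI impI conjI)
      fix p assume p: "p < k"
      show "t u p < t v p"
      proof (rule ccontr)
        assume "\<not> t u p < t v p"
        then have vu: "t v p < t u p" using inj[OF u v ne p p] by simp
        \<comment> \<open>Up to time \<open>t v p\<close> the letter \<open>v\<close> has occurred
          \<open>p + 1\<close> times, but \<open>u\<close> at most \<open>p\<close> times.\<close>
        have "{q. q < k \<and> t u q \<le> t v p} \<subseteq> {..<p}"
          using less_iff[OF u _ p] by (auto dest: le_less_trans[OF _ vu])
        from card_mono[OF _ this] have "card {q. q < k \<and> t u q \<le> t v p} \<le> p" by simp
        moreover have "t v p \<in> D" using v p by (auto simp: D_def)
        ultimately show False using R'[of "t v p"] self[OF v p] by simp
      qed
      assume p1: "p + 1 < k"
      show "t v p < t u (p + 1)"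
      proof (rule ccontr)
        assume "\<not> t v p < t u (p + 1)"
        then have uv: "t u (p + 1) < t v p" using inj[OF u v ne p1 p] by simp
        have "{q. q < k \<and> t v q \<le> t u (p + 1)} \<subseteq> {..<p}"
          using less_iff[OF v _ p] by (auto dest: le_less_trans[OF _ uv[simplified]])
        from card_mono[OF _ this] have "card {q. q < k \<and> t v q \<le> t u (p + 1)} \<le> p" by simp
        moreover have "t u (p + 1) \<in> D" using u p1 by (auto simp: D_def)
        ultimately show False using R'[of "t u (p + 1)"] self[OF u p1] by simp
      qed
    qed
  qed
  have "w \<in> lists (verts G)" using g by (auto simp: w_def ts D_def)
  then show ?thesis
    unfolding word_representable_def
    using edges precedes alternate_iff_precedes[of _ _ w] by (intro bexI[of _ w]) auto
qed

definition compatible :: "'a graph \<Rightarrow> nat \<Rightarrow> ('a \<Rightarrow> nat \<Rightarrow> 'b::linorder) \<Rightarrow> 'a \<Rightarrow> 'a \<Rightarrow> bool" where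
  "compatible G k t u v \<longleftrightarrow> (\<forall>p<k. \<forall>q<k. t u p \<noteq> t v q) \<and>
     ({u, v} \<in> edges G \<longleftrightarrow> interleaved k t u v \<or> interleaved k t v u)"

lemma compatible_commute: "compatible G k t u v \<longleftrightarrow> compatible G k t v u"
proof -
  have "(\<forall>p<k. \<forall>q<k. t u p \<noteq> t v q) \<longleftrightarrow> (\<forall>p<k. \<forall>q<k. t v p \<noteq> t u q)" by metis
  then show ?thesis unfolding compatible_def by (simp only: insert_commute disj_commute)
qed

lemma word_representable_induced_compatible:
  assumes "finite S"
    and "\<And>v p. v \<in> S \<Longrightarrow> p + 1 < k \<Longrightarrow> t v p < t v (p + 1)"
    and C: "\<And>u v. u \<in> S \<Longrightarrow> v \<in> S \<Longrightarrow> u \<noteq> v \<Longrightarrow> compatible G k t u v"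
  shows "word_representable (induced_subgraph G S)"
proof (rule word_representable_timed)
  fix u v
  assume *: "u \<in> verts (induced_subgraph G S)" "v \<in> verts (induced_subgraph G S)" "u \<noteq> v"
  then have "compatible G k t u v" using C by (simp add: induced_subgraph_def)
  then show "p < k \<Longrightarrow> q < k \<Longrightarrow> t u p \<noteq> t v q" for p q by (simp add: compatible_def)
  show "{u, v} \<in> edges (induced_subgraph G S) \<longleftrightarrow> interleaved k t u v \<or> interleaved k t v u"
    using \<open>compatible G k t u v\<close> * by (simp add: compatible_def induced_subgraph_def)
qed (use assms in \<open>simp_all add: induced_subgraph_def\<close>)

lemma all_less_2: "(\<forall>p<2. P p) \<longleftrightarrow> P 0 \<and> P (1::nat)"
  by (auto simp: less_2_cases_iff)

lemma all_less_3: "(\<forall>p<3. P p) \<longleftrightarrow> P 0 \<and> P 1 \<and> P (2::nat)"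
proof -
  have "p < 3 \<longleftrightarrow> p = 0 \<or> p = 1 \<or> p = 2" for p :: nat by linarith
  then show ?thesis by auto
qed

lemma interleaved_2:
  "interleaved 2 t u v \<longleftrightarrow> t u 0 < t v 0 \<and> t v 0 < t u 1 \<and> t u 1 < t v 1"
  unfolding interleaved_def all_less_2 by simp

lemma interleaved_3:
  "interleaved 3 t u v \<longleftrightarrow>
    t u 0 < t v 0 \<and> t v 0 < t u 1 \<and> t u 1 < t v 1 \<and> t v 1 < t u 2 \<and> t u 2 < t v 2"
  unfolding interleaved_def all_less_3 by (simp add: numeral_2_eq_2)

section \<open>Words for the proper induced subgraphs\<close>

text \<open>Two linear extensions realising the fence order on a path: \<open>a < b\<close> in both orders iff \<open>a\<close> is a
  source, \<open>b\<close> is a sink and the positions differ by at most one.\<close>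

definition fence1 :: "bool \<Rightarrow> nat \<Rightarrow> int" where
  "fence1 source i = (if source then 2 * int i - 3 else 2 * int i)"

definition fence2 :: "bool \<Rightarrow> nat \<Rightarrow> int" where
  "fence2 source i = (if source then - 2 * int i - 3 else - 2 * int i)"

text \<open>For a source \<open>i\<close> and a sink \<open>k\<close> the two comparisons say
  \<open>i \<le> k + 1\<close> and \<open>k \<le> i + 1\<close>. Vertices of equal kind are ordered
  oppositely by the two orders, and a sink never precedes a source in both.\<close>

lemma fence_less:
  assumes "i \<noteq> k"
  shows "fence1 s i < fence1 s' k \<and> fence2 s i < fence2 s' k \<longleftrightarrow>
    s \<and> \<not> s' \<and> (k = i + 1 \<or> i = k + 1)"
  using assms by (auto simp: fence1_def fence2_def)

text \<open>Sources have odd values and sinks even ones.\<close>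

lemma fence_inj:
  assumes "i \<noteq> k"
  shows "fence1 s i \<noteq> fence1 s' k" "fence2 s i \<noteq> fence2 s' k"
  using assms unfolding fence1_def fence2_def by (auto; presburger)+

lemma G4_vertex_cases:
  assumes "v \<in> verts (G4 n)"
  obtains "v = N 1" | "v = N (2*n+1)" | "v = X" | "v = Y" | i where "v = N i" "i \<in> {2..2*n}"
proof (cases v)
  case (N i)
  then have "i = 1 \<or> i = 2*n+1 \<or> i \<in> {2..2*n}" using assms by (auto simp: G4_verts)
  then show ?thesis using N that by blast
qed (use that in auto)

lemma G4_word_representable_induced:
  assumes S: "S \<subseteq> verts (G4 n)"
    and mono: "\<And>v p. v \<in> S \<Longrightarrow> p + 1 < k \<Longrightarrow> t v p < t v (p + 1)"
    and AB: "N 1 \<in> S \<Longrightarrow> N (2*n+1) \<in> S \<Longrightarrow> compatible (G4 n) k t (N 1) (N (2*n+1))"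
    and AX: "N 1 \<in> S \<Longrightarrow> X \<in> S \<Longrightarrow> compatible (G4 n) k t (N 1) X"
    and AY: "N 1 \<in> S \<Longrightarrow> Y \<in> S \<Longrightarrow> compatible (G4 n) k t (N 1) Y"
    and BX: "N (2*n+1) \<in> S \<Longrightarrow> X \<in> S \<Longrightarrow> compatible (G4 n) k t (N (2*n+1)) X"
    and BY: "N (2*n+1) \<in> S \<Longrightarrow> Y \<in> S \<Longrightarrow> compatible (G4 n) k t (N (2*n+1)) Y"
    and XY: "X \<in> S \<Longrightarrow> Y \<in> S \<Longrightarrow> compatible (G4 n) k t X Y"
    and path: "\<And>i. i \<in> {2..2*n} \<Longrightarrow> N i \<in> S \<Longrightarrow> N 1 \<in> S \<Longrightarrow> compatible (G4 n) k t (N i) (N 1)"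
      "\<And>i. i \<in> {2..2*n} \<Longrightarrow> N i \<in> S \<Longrightarrow> N (2*n+1) \<in> S \<Longrightarrow> compatible (G4 n) k t (N i) (N (2*n+1))"
      "\<And>i. i \<in> {2..2*n} \<Longrightarrow> N i \<in> S \<Longrightarrow> X \<in> S \<Longrightarrow> compatible (G4 n) k t (N i) X"
      "\<And>i. i \<in> {2..2*n} \<Longrightarrow> N i \<in> S \<Longrightarrow> Y \<in> S \<Longrightarrow> compatible (G4 n) k t (N i) Y"
      "\<And>i j. i \<in> {2..2*n} \<Longrightarrow> j \<in> {2..2*n} \<Longrightarrow> i \<noteq> j \<Longrightarrow> N i \<in> S \<Longrightarrow> N j \<in> S \<Longrightarrow>
        compatible (G4 n) k t (N i) (N j)"
  shows "word_representable (induced_subgraph (G4 n) S)"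
proof (rule word_representable_induced_compatible)
  show "finite S" using S finite_subset[of S "verts (G4 n)"] by (simp add: G4_def)
  fix u v
  assume uv: "u \<in> S" "v \<in> S" "u \<noteq> v"
  then have V: "u \<in> verts (G4 n)" "v \<in> verts (G4 n)" using S by auto
  note C = AB AX AY BX BY XY path
  note C = C C[THEN compatible_commute[THEN iffD1]]
  from V(1) show "compatible (G4 n) k t u v"
  proof (cases rule: G4_vertex_cases)
    case 1
    from V(2) show ?thesis by (cases rule: G4_vertex_cases) (use uv 1 C in simp_all)
  next
    case 2
    from V(2) show ?thesis by (cases rule: G4_vertex_cases) (use uv 2 C in simp_all)
  next
    case 3
    from V(2) show ?thesis by (cases rule: G4_vertex_cases) (use uv 3 C in simp_all)
  next
    case 4
    from V(2) show ?thesis by (cases rule: G4_vertex_cases) (use uv 4 C in simp_all)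
  next
    case (5 i)
    from V(2) show ?thesis by (cases rule: G4_vertex_cases) (use uv 5 C in simp_all)
  qed
qed (rule mono)

lemma G4_edges_const:
  assumes "n \<ge> 3"
  shows
    "{N 1, N (2*n+1)} \<in> edges (G4 n)" "{N 1, X} \<in> edges (G4 n)"
    "{N 1, Y} \<notin> edges (G4 n)" "{N (2*n+1), X} \<notin> edges (G4 n)"
    "{N (2*n+1), Y} \<in> edges (G4 n)" "{X, Y} \<notin> edges (G4 n)"
proof -
  show "{N 1, N (2*n+1)} \<in> edges (G4 n)"
    by (rule G4_edges_hubs(3)[of 2]) (use assms in simp)
qed (use assms in \<open>simp_all add: G4_edges_XY\<close>)

lemma G4_edges_path_vertex:
  assumes "i \<in> {2..2*n}"
  shows
    "{N i, N 1} \<in> edges (G4 n)" "{N i, N (2*n+1)} \<in> edges (G4 n)"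
    "{N i, X} \<in> edges (G4 n) \<longleftrightarrow> i = 2*n" "{N i, Y} \<in> edges (G4 n) \<longleftrightarrow> i = 2"
proof -
  show "{N i, N 1} \<in> edges (G4 n)" "{N i, N (2*n+1)} \<in> edges (G4 n)"
    using G4_edges_hubs(1,2)[OF assms] by (simp_all only: insert_commute)
qed (use assms in \<open>simp_all add: G4_edges_XY\<close>)

text \<open>Without one of the hubs, \<open>Y, 2, \<dots>, 2n, X\<close> is a path (\<open>Y\<close> and \<open>X\<close> take the positions \<open>1\<close> and
  \<open>2n+1\<close>) and the remaining hub sees all of it but one end. Two copies of the path in the orders
  \<open>fence1\<close>, \<open>fence2\<close> represent it; a hub follows each copy, except that it comes before the end vertex it
  does not see in the order where that vertex is last.\<close>

fun hubless_time :: "nat \<Rightarrow> vertex \<Rightarrow> nat \<Rightarrow> int" where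
  "hubless_time n X p = (if p = 0 then 4 * int n + 2 else 4 * int n + 8)"
| "hubless_time n Y p = (if p = 0 then 2 else 8 * int n + 8)"
| "hubless_time n (N i) p =
    (if i = 1 then (if p = 0 then 4 * int n + 3 else 8 * int n + 5)
     else if i = 2*n+1 then (if p = 0 then 4 * int n else 8 * int n + 9)
     else (if p = 0 then fence1 (even i) i else 8 * int n + 10 + fence2 (even i) i))"

lemma word_representable_without_hub:
  assumes n: "n \<ge> 3" and S: "S \<subseteq> verts (G4 n)" and hub: "N 1 \<notin> S \<or> N (2*n+1) \<notin> S"
  shows "word_representable (induced_subgraph (G4 n) S)"
proof -
  define t where "t = hubless_time n"
  \<comment> \<open>The times of \<open>X\<close> and \<open>Y\<close> are the fence values of sinks
    at positions \<open>2n+1\<close> and \<open>1\<close>, the second copy being shifted by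
    \<open>8n+10\<close>.\<close>
  have X: "t X 0 = 4 * int n + 2" "t X 1 = 4 * int n + 8"
    and Y: "t Y 0 = 2" "t Y 1 = 8 * int n + 8"
    and A: "t (N 1) 0 = 4 * int n + 3" "t (N 1) 1 = 8 * int n + 5"
    and B: "t (N (2*n+1)) 0 = 4 * int n" "t (N (2*n+1)) 1 = 8 * int n + 9"
    using n by (simp_all add: t_def)
  have P: "t (N i) 0 = fence1 (even i) i" "t (N i) 1 = 8 * int n + 10 + fence2 (even i) i"
    if "i \<in> {2..2*n}" for i
    using that by (simp_all add: t_def)
  have b: "1 \<le> t (N i) 0" "t (N i) 0 \<noteq> 2" "t (N i) 0 < 4 * int n - 1"
    "4 * int n + 7 \<le> t (N i) 1" "t (N i) 1 \<le> 8 * int n + 4" "t (N i) 1 \<noteq> 4 * int n + 8"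
    "t (N i) 1 < 4 * int n + 8 \<longleftrightarrow> i = 2*n" "t (N i) 0 < 2 \<longleftrightarrow> i = 2"
    if "i \<in> {2..2*n}" for i
    using that n unfolding P[OF that] fence1_def fence2_def by (auto; presburger)+
  show ?thesis
  proof (rule G4_word_representable_induced[where t = t and k = 2, OF S])
    show "t v p < t v (p + 1)" if "v \<in> S" "p + 1 < 2" for v p
    proof -
      have "v \<in> verts (G4 n)" "p = 0" using that S by auto
      then show ?thesis
      proof (cases rule: G4_vertex_cases)
        case (5 i)
        then show ?thesis using b(3,4)[OF 5(2)] unfolding \<open>p = 0\<close> add_0 5(1) by linarith
      qed (use n in \<open>simp_all only: \<open>p = 0\<close> add_0 X Y A B\<close>)
    qed
  next
    fix i
    assume i: "i \<in> {2..2*n}"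
    note defs = compatible_def interleaved_2 all_less_2
    note bi = b[OF i] and e = G4_edges_path_vertex[OF i]
    show "compatible (G4 n) 2 t (N i) (N 1)" unfolding defs A using bi e by auto
    show "compatible (G4 n) 2 t (N i) (N (2*n+1))" unfolding defs B using bi e by auto
    show "compatible (G4 n) 2 t (N i) X" unfolding defs X using bi e n by auto
    show "compatible (G4 n) 2 t (N i) Y" unfolding defs Y using bi e by auto
    fix j
    assume j: "j \<in> {2..2*n}" and ij: "i \<noteq> j"
    have "t (N i) 0 \<noteq> t (N j) 0" "t (N i) 1 \<noteq> t (N j) 1"
      unfolding P[OF i] P[OF j] using fence_inj[OF ij] by simp_all
    moreover have "t (N i) 0 < t (N j) 1" "t (N j) 0 < t (N i) 1"
      using bi(3,4) b(3,4)[OF j] by linarith+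
    moreover have "t (N i) 0 < t (N j) 0 \<and> t (N i) 1 < t (N j) 1 \<longleftrightarrow>
        even i \<and> odd j \<and> (j = i + 1 \<or> i = j + 1)"
      "t (N j) 0 < t (N i) 0 \<and> t (N j) 1 < t (N i) 1 \<longleftrightarrow>
        even j \<and> odd i \<and> (j = i + 1 \<or> i = j + 1)"
      unfolding P[OF i] P[OF j] using fence_less[OF ij] fence_less[OF ij[symmetric]] by auto
    moreover have "even i \<noteq> even j" if "j = i + 1 \<or> i = j + 1" using that by auto
    ultimately show "compatible (G4 n) 2 t (N i) (N j)"
      unfolding defs G4_edges_path[OF i j] by auto
  next
    note defs = compatible_def interleaved_2 all_less_2
    note e = G4_edges_const[OF n]
    show "compatible (G4 n) 2 t (N 1) X" unfolding defs A X using e n by auto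
    show "compatible (G4 n) 2 t (N 1) Y" unfolding defs A Y using e n by auto
    show "compatible (G4 n) 2 t (N (2*n+1)) X" unfolding defs B X using e n by auto
    show "compatible (G4 n) 2 t (N (2*n+1)) Y" unfolding defs B Y using e n by auto
    show "compatible (G4 n) 2 t X Y" unfolding defs X Y using e n by auto
  \<comment> \<open>What remains is the edge between the hubs. Their four times come in the order
    \<open>2n+1\<close>, \<open>1\<close>, \<open>1\<close>, \<open>2n+1\<close>, so they could not
    both be kept.\<close>
  qed (use hub in blast)
qed
text \<open>Delete the path vertex \<open>j\<close>, where \<open>j = 1\<close> and \<open>j = 2n+1\<close> stand for the deletion of \<open>Y\<close> and \<open>X\<close>. Orient
  each piece of the path alternately with \<open>2\<close> a source and \<open>2n\<close> a sink. The word is then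
  \<open>x P\<^sub>1 A x y B P\<^sub>2 A y B 2 y P\<^sub>1' x (2n) A B\<close>, where \<open>P\<^sub>1\<close>, \<open>P\<^sub>2\<close> list the path in the orders \<open>fence1\<close>,
  \<open>fence2\<close>, and \<open>P\<^sub>1 = 2 P\<^sub>1' (2n)\<close>.\<close>

fun gap_time :: "nat \<Rightarrow> nat \<Rightarrow> vertex \<Rightarrow> nat \<Rightarrow> int" where
  "gap_time n j X p = (if p = 0 then 0 else if p = 1 then 4 * int n + 2 else 12 * int n + 9)"
| "gap_time n j Y p = (if p = 0 then 4 * int n + 3 else if p = 1 then 8 * int n + 8 else 8 * int n + 12)"
| "gap_time n j (N i) p =
    (if i = 1 then
       (if p = 0 then 4 * int n + 1 else if p = 1 then 8 * int n + 7 else 12 * int n + 11)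
     else if i = 2*n+1 then
       (if p = 0 then 4 * int n + 4 else if p = 1 then 8 * int n + 9 else 12 * int n + 12)
     else if p = 0 then fence1 (even i = (i < j)) i
     else if p = 1 then 8 * int n + 10 + fence2 (even i = (i < j)) i
     else 8 * int n + 10 + fence1 (even i = (i < j)) i)"

lemma word_representable_with_gap:
  assumes n: "n \<ge> 3" and S: "S \<subseteq> verts (G4 n)"
    and jX: "X \<in> S \<Longrightarrow> j \<le> 2*n" and jY: "Y \<in> S \<Longrightarrow> 2 \<le> j"
    and gap: "j \<in> {2..2*n} \<Longrightarrow> N j \<notin> S"
  shows "word_representable (induced_subgraph (G4 n) S)"
proof -
  define t where "t = gap_time n j"
  \<comment> \<open>Sources are the even positions before \<open>j\<close> and the odd ones after
    it. This change of phase makes \<open>2\<close> a source when \<open>2 < j\<close> and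
    \<open>2n\<close> a sink when \<open>j < 2n\<close>; neighbours that both survive lie on one
    side of \<open>j\<close>, so they still differ.\<close>
  define s where "s i \<longleftrightarrow> even i = (i < j)" for i
  have X: "t X 0 = 0" "t X 1 = 4 * int n + 2" "t X 2 = 12 * int n + 9"
    and Y: "t Y 0 = 4 * int n + 3" "t Y 1 = 8 * int n + 8" "t Y 2 = 8 * int n + 12"
    and A: "t (N 1) 0 = 4 * int n + 1" "t (N 1) 1 = 8 * int n + 7" "t (N 1) 2 = 12 * int n + 11"
    and B: "t (N (2*n+1)) 0 = 4 * int n + 4" "t (N (2*n+1)) 1 = 8 * int n + 9"
      "t (N (2*n+1)) 2 = 12 * int n + 12"
    using n by (simp_all add: t_def)
  have P: "t (N i) 0 = fence1 (s i) i" "t (N i) 1 = 8 * int n + 10 + fence2 (s i) i"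
    "t (N i) 2 = 8 * int n + 10 + fence1 (s i) i"
    if "i \<in> {2..2*n}" for i
    using that by (simp_all add: t_def s_def)
  have b: "1 \<le> t (N i) 0" "t (N i) 0 \<le> 4 * int n"
    "4 * int n + 7 \<le> t (N i) 1" "t (N i) 1 \<le> 8 * int n + 6"
    "8 * int n + 11 \<le> t (N i) 2" "t (N i) 2 \<le> 12 * int n + 10"
    if "i \<in> {2..2*n}" for i
    using that n unfolding P[OF that] fence1_def fence2_def by auto
  \<comment> \<open>The third occurrences single out the ends: \<open>12n+9\<close> lies just below
    the sink \<open>2n\<close> at \<open>12n+10\<close> and above all other path vertices. Likewise
    \<open>8n+12\<close> below lies just above the source \<open>2\<close> at
    \<open>8n+11\<close>.\<close>
  have bX: "t (N i) 2 \<noteq> 12 * int n + 9" "12 * int n + 9 < t (N i) 2 \<longleftrightarrow> i = 2*n"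
    if "i \<in> {2..2*n}" "N i \<in> S" "X \<in> S" for i
  proof -
    have "i \<noteq> j" "j \<le> 2*n" using that gap jX by blast+
    then have "i = 2*n \<Longrightarrow> \<not> s i" by (simp add: s_def)
    then show "t (N i) 2 \<noteq> 12 * int n + 9" "12 * int n + 9 < t (N i) 2 \<longleftrightarrow> i = 2*n"
      using that(1) unfolding P[OF that(1)] fence1_def by (auto; presburger)+
  qed
  have bY: "t (N i) 2 \<noteq> 8 * int n + 12" "t (N i) 2 < 8 * int n + 12 \<longleftrightarrow> i = 2"
    if "i \<in> {2..2*n}" "N i \<in> S" "Y \<in> S" for i
  proof -
    have "i \<noteq> j" "2 \<le> j" using that gap jY by blast+
    then have "i = 2 \<Longrightarrow> s i" by (simp add: s_def)
    then show "t (N i) 2 \<noteq> 8 * int n + 12" "t (N i) 2 < 8 * int n + 12 \<longleftrightarrow> i = 2"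
      using that(1) unfolding P[OF that(1)] fence1_def by (auto; presburger)+
  qed
  show ?thesis
  proof (rule G4_word_representable_induced[where t = t and k = 3, OF S])
    show "t v p < t v (p + 1)" if "v \<in> S" "p + 1 < 3" for v p
    proof -
      have "v \<in> verts (G4 n)" "p = 0 \<or> p = 1" using that S by auto
      then have "t v 0 < t v 1 \<and> t v 1 < t v 2"
      proof (cases rule: G4_vertex_cases)
        case (5 i)
        then show ?thesis using b[OF 5(2)] unfolding 5(1) by linarith
      qed (use n in \<open>simp_all only: X Y A B, auto\<close>)
      then show ?thesis using \<open>p = 0 \<or> p = 1\<close> by (auto simp: numeral_2_eq_2)
    qed
  next
    fix i
    assume i: "i \<in> {2..2*n}" and iS: "N i \<in> S"
    note defs = compatible_def interleaved_3 all_less_3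
    note bi = b[OF i] and e = G4_edges_path_vertex[OF i]
    show "compatible (G4 n) 3 t (N i) (N 1)" unfolding defs A using bi e by auto
    show "compatible (G4 n) 3 t (N i) (N (2*n+1))" unfolding defs B using bi e by auto
    show "compatible (G4 n) 3 t (N i) X" if "X \<in> S"
      unfolding defs X using bi bX[OF i iS that] e n by auto
    show "compatible (G4 n) 3 t (N i) Y" if "Y \<in> S"
      unfolding defs Y using bi bY[OF i iS that] e n by auto
    fix k
    assume k: "k \<in> {2..2*n}" and ik: "i \<noteq> k" and kS: "N k \<in> S"
    have cross: "t (N i) 0 < t (N k) 1" "t (N k) 0 < t (N i) 1" "t (N i) 1 < t (N k) 2"
      "t (N k) 1 < t (N i) 2" "t (N i) 0 < t (N k) 2" "t (N k) 0 < t (N i) 2"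
      using bi b[OF k] by linarith+
    have "interleaved 3 t (N i) (N k) \<longleftrightarrow>
        t (N i) 0 < t (N k) 0 \<and> t (N i) 1 < t (N k) 1 \<and> t (N i) 2 < t (N k) 2"
      unfolding interleaved_3 by (simp only: cross simp_thms)
    also have "\<dots> \<longleftrightarrow> s i \<and> \<not> s k \<and> (k = i + 1 \<or> i = k + 1)"
      unfolding P[OF i] P[OF k] using fence_less[OF ik] by auto
    finally have ik_iff: "interleaved 3 t (N i) (N k) \<longleftrightarrow> \<dots>" .
    have "interleaved 3 t (N k) (N i) \<longleftrightarrow>
        t (N k) 0 < t (N i) 0 \<and> t (N k) 1 < t (N i) 1 \<and> t (N k) 2 < t (N i) 2"
      unfolding interleaved_3 by (simp only: cross simp_thms)
    also have "\<dots> \<longleftrightarrow> s k \<and> \<not> s i \<and> (i = k + 1 \<or> k = i + 1)"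
      unfolding P[OF i] P[OF k] using fence_less[OF ik[symmetric]] by auto
    finally have ki_iff: "interleaved 3 t (N k) (N i) \<longleftrightarrow> \<dots>" .
    have "s i \<noteq> s k" if "k = i + 1 \<or> i = k + 1"
    proof -
      have "i \<noteq> j" "k \<noteq> j" using i k iS kS gap by blast+
      then have "i < j \<longleftrightarrow> k < j" using that by linarith
      then show ?thesis using that by (auto simp: s_def)
    qed
    then have "{N i, N k} \<in> edges (G4 n) \<longleftrightarrow> interleaved 3 t (N i) (N k) \<or> interleaved 3 t (N k) (N i)"
      unfolding G4_edges_path[OF i k] ik_iff ki_iff by blast
    moreover have "t (N i) 0 \<noteq> t (N k) 0" "t (N i) 1 \<noteq> t (N k) 1" "t (N i) 2 \<noteq> t (N k) 2"
      unfolding P[OF i] P[OF k] using fence_inj[OF ik] by simp_all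
    ultimately show "compatible (G4 n) 3 t (N i) (N k)"
      unfolding compatible_def all_less_3
      using cross[THEN less_imp_neq] cross[THEN less_imp_neq, symmetric] by simp
  next
    note defs = compatible_def interleaved_3 all_less_3
    note e = G4_edges_const[OF n]
    show "compatible (G4 n) 3 t (N 1) (N (2*n+1))" unfolding defs A B using e n by auto
    show "compatible (G4 n) 3 t (N 1) X" unfolding defs A X using e n by auto
    show "compatible (G4 n) 3 t (N 1) Y" unfolding defs A Y using e n by auto
    show "compatible (G4 n) 3 t (N (2*n+1)) X" unfolding defs B X using e n by auto
    show "compatible (G4 n) 3 t (N (2*n+1)) Y" unfolding defs B Y using e n by auto
    show "compatible (G4 n) 3 t X Y" unfolding defs X Y using e n by auto
  qed
qed

theorem theorem11:
  fixes n :: nat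
  assumes "n \<ge> 3"
  shows "minimal_non_word_representable (G4 n)"
  unfolding minimal_non_word_representable_def
proof (intro conjI allI impI)
  show "\<not> word_representable (G4 n)" by (rule G4_not_word_representable[OF assms])
  fix S
  assume "S \<subset> verts (G4 n)"
  then obtain v where S: "S \<subseteq> verts (G4 n)" and v: "v \<in> verts (G4 n)" "v \<notin> S" by blast
  note gap = word_representable_with_gap[OF assms S]
  from v(1) show "word_representable (induced_subgraph (G4 n) S)"
  proof (cases rule: G4_vertex_cases)
    case 1
    then have "N 1 \<notin> S" using v by simp
    then show ?thesis by (intro word_representable_without_hub[OF assms S] disjI1)
  next
    case 2
    then have "N (2*n+1) \<notin> S" using v by simp
    then show ?thesis by (intro word_representable_without_hub[OF assms S] disjI2)
  next
    case 3
    then have "X \<notin> S" using v by simp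
    then show ?thesis using assms by (intro gap[of "2*n+1"]) simp_all
  next
    case 4
    then have "Y \<notin> S" using v by simp
    then show ?thesis using assms by (intro gap[of 1]) simp_all
  next
    case (5 i)
    then have "N i \<notin> S" using v by simp
    then show ?thesis using 5 by (intro gap[of i]) simp_all
  qed
qed

end
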